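(* Let $A$ be the formal power series in the three variables $u,v,t$ defined by $$A(u,v,t):=\sum_{r,s,k\ge 0}a(r,s,k)\,u^r\,\frac{v^s t^k}{(s+k)!}.$$ Then $A$ is the unique solution of $$0=\Big(\frac vt e^t-1\Big)A(u,v,t)+\Big(u-\frac vt\Big)A(u,v,0)+1$$ in the ring of formal power series in $u$, $v$ and $t$.
   Context: Car parking problem: a car park has $n$ spaces in a line, numbered $1,\dots,n$, and $m$ drivers arrive one after the other. Each driver has chosen a preferred space, so an assignment is a function $f:\{1,\dots,m\}\to\{1,\dots,n\}$. Each arriving driver parks in the chosen space if it is free; otherwise the driver takes the first free space with a larger number, if there is one; if there is none, the driver goes home. For $r,s,k\in\mathbb N_0$, $a(r,s,k)$ denotes the number of assignments of $m=s+k$ drivers to $n=r+s$ spaces for which, in the end, $r$ spaces remain unoccupied, $s$ spaces are occupied, and $k$ drivers go home. (For $n=0$ there is exactly one assignment if $m=0$ and none if $m>0$.) $A(u,v,0)$ denotes the series obtained from $A(u,v,t)$ by setting $t=0$. The equation is read with formal series in which the factor $1/t$ is allowed. *)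

theory Defs
  imports "HOL-Computational_Algebra.Computational_Algebra" "HOL-Library.FuncSet"
begin

section \<open>The parking process\<close>

text \<open>
  The space taken by a driver with preferred space \<open>p\<close> in a car park with spaces
  \<open>{1..n}\<close>, of which those in \<open>S\<close> are already occupied; \<open>None\<close> means that
  the driver goes home.
\<close>

definition space_taken :: "nat \<Rightarrow> nat set \<Rightarrow> nat \<Rightarrow> nat option" where
  "space_taken n S p =
     (if p \<notin> S then Some p
      else if {p<..n} - S \<noteq> {} then Some (Min ({p<..n} - S))
      else None)"

text \<open>The set of spaces occupied after the drivers \<open>1, \<dots>, i\<close> have arrived.\<close>

primrec occupied :: "nat \<Rightarrow> (nat \<Rightarrow> nat) \<Rightarrow> nat \<Rightarrow> nat set" where
  "occupied n f 0 = {}"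
| "occupied n f (Suc i) =
     (case space_taken n (occupied n f i) (f (Suc i)) of
        None \<Rightarrow> occupied n f i
      | Some q \<Rightarrow> insert q (occupied n f i))"

definition gone_home :: "nat \<Rightarrow> nat \<Rightarrow> (nat \<Rightarrow> nat) \<Rightarrow> nat set" where
  "gone_home m n f = {i \<in> {1..m}. space_taken n (occupied n f (i - 1)) (f i) = None}"

text \<open>
  Assignments are extensional functions, so that each map from \<open>{1..m}\<close> to \<open>{1..n}\<close>
  is counted once; for \<open>n = 0\<close> there is one if \<open>m = 0\<close> and none otherwise.
\<close>

definition num_assignments :: "nat \<Rightarrow> nat \<Rightarrow> nat \<Rightarrow> nat" where
  "num_assignments r s k =
     card {f \<in> {1..s + k} \<rightarrow>\<^sub>E {1..r + s}.
             card ({1..r + s} - occupied (r + s) f (s + k)) = r \<and>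
             card (occupied (r + s) f (s + k)) = s \<and>
             card (gone_home (s + k) (r + s) f) = k}"

section \<open>Power series in three variables\<close>

text \<open>
  The ring of formal power series in \<open>u\<close>, \<open>v\<close>, \<open>t\<close> over a field \<open>'a\<close> of
  characteristic 0 is rendered as \<open>'a fps fps fps\<close>: the innermost variable is \<open>u\<close>, the
  middle one \<open>v\<close> and the outermost one \<open>t\<close>, so the coefficient of
  \<open>u^r v^s t^k\<close> in \<open>F\<close> is \<open>F $ k $ s $ r\<close>.
\<close>

definition parking_series :: "'a::field_char_0 fps fps fps" where
  "parking_series =
     Abs_fps (\<lambda>k. Abs_fps (\<lambda>s. Abs_fps (\<lambda>r.
       of_nat (num_assignments r s k) / fact (s + k))))"

text \<open>
  Since \<open>1/t\<close> occurs in the equation, it is stated in the ring \<open>'a fps fps fls\<close> of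
  formal Laurent series in \<open>t\<close> over the power series in \<open>u\<close> and \<open>v\<close>. This
  ring contains \<open>'a fps fps fps\<close> via \<open>fps_to_fls\<close>.
\<close>

definition u_var :: "'a::field_char_0 fps fps fls" where
  "u_var = fls_const (fps_const fps_X)"

definition v_var :: "'a::field_char_0 fps fps fls" where
  "v_var = fls_const fps_X"

definition t_inv :: "'a::field_char_0 fps fps fls" where
  "t_inv = fls_X_inv"

lemma t_inv_times_t: "t_inv * fls_X = (1 :: 'a::field_char_0 fps fps fls)"
  by (simp add: t_inv_def fls_X_inv_times_conv_shift fls_X_conv_shift_1)

definition exp_t :: "'a::field_char_0 fps fps fls" where
  "exp_t = fps_to_fls (fps_exp 1)"

text \<open>
  The coefficients of \<open>fps_exp\<close> are computed here by division in \<open>'a fps fps\<close>, which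
  is not a field; they are the expected constants.
\<close>

lemma fps_exp_1_nth:
  "(fps_exp 1 :: 'a::field_char_0 fps fps fps) $ n = fps_const (fps_const (1 / fact n))"
proof -
  have "(of_nat (fact n) :: 'a fps fps) = fps_const (fps_const (fact n))"
    by (metis fps_of_nat of_nat_fact)
  then show ?thesis
    by (simp add: fps_exp_def fps_const_inverse divide_inverse del: of_nat_fact)
qed

definition at_t_zero :: "'a::field_char_0 fps fps fps \<Rightarrow> 'a fps fps fls" where
  "at_t_zero F = fls_const (F $ 0)"

end

theory Submission
  imports Defs
begin

text \<open>
  Both halves of the theorem come from one recurrence. Multiplying the equation by \<open>t\<close>, which is
  a nonzerodivisor among Laurent series, gives an equation between power series without \<open>1/t\<close>.
  Its coefficient of \<open>t^0\<close> vanishes for every \<open>B\<close>. Write \<open>b(r,s,k)\<close> for the coefficient of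
  \<open>u^r v^s t^k\<close> in \<open>B\<close>; then the remaining coefficients say
  \<open>b(r,s,k) = [k = 0] ([r = s = 0] + b(r-1,s,0)) + (\<Sum>i\<le>k+1. b(r,s-1,i) / (k+1-i)!)\<close>,
  where terms with a negative index are zero (\<open>equation_iff_recurrence\<close>).

  This recurrence has at most one solution (\<open>parking_recurrence_unique\<close>): the sum uses only
  the layer \<open>s - 1\<close>, and within a layer the other term decreases \<open>r\<close>.

  The numbers \<open>a(r,s,k) / (s+k)!\<close> satisfy it (\<open>parking_series_recurrence\<close>) because a nonempty
  car park can be split at its last space. The other spaces behave exactly like a smaller car
  park used only by the drivers who prefer one of them, and the last space receives those
  who go home from the smaller car park and those who prefer the last space. If nobody
  reaches it, then nobody goes home and there is one free space less to account for; this gives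
  \<open>a(r-1,s,0)\<close>. If it is occupied, then \<open>k + 1\<close> drivers reach it, \<open>i\<close> of them by overflow from the
  smaller car park, whose \<open>s - 1 + i\<close> drivers can be any subset of the \<open>s + k\<close> drivers; this gives
  \<open>binom(s+k, s-1+i) a(r,s-1,i)\<close> (\<open>num_assignments_rec\<close>). Division by \<open>(s+k)!\<close> turns the binomial
  coefficient into the factor \<open>1/(k+1-i)!\<close>.

  The drivers of the smaller car park are not numbered consecutively, so the process is
  studied on lists of preferences, where forgetting drivers is filtering the list.
\<close>

section \<open>The parking process on lists of preferences\<close>

definition park_step :: "nat \<Rightarrow> nat set \<Rightarrow> nat \<Rightarrow> nat set" where
  "park_step n S p = (case space_taken n S p of None \<Rightarrow> S | Some q \<Rightarrow> insert q S)"

definition parked :: "nat \<Rightarrow> nat list \<Rightarrow> nat set" where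
  "parked n xs = foldl (park_step n) {} xs"

lemma parked_Nil [simp]: "parked n [] = {}"
  by (simp add: parked_def)

lemma parked_snoc [simp]: "parked n (xs @ [p]) = park_step n (parked n xs) p"
  by (simp add: parked_def)

lemma occupied_eq_parked: "occupied n f i = parked n (map f [1..<Suc i])"
proof (induction i)
  case (Suc i)
  have "[1..<Suc (Suc i)] = [1..<Suc i] @ [Suc i]"
    by simp
  then show ?case
    using Suc by (simp add: park_step_def del: upt_Suc split: option.splits)
qed simp

lemma space_taken_SomeD:
  assumes "space_taken n S p = Some q"
  shows "q \<notin> S" and "p \<in> {1..n} \<Longrightarrow> q \<in> {1..n}"
proof -
  have "Min ({p<..n} - S) \<in> {p<..n} - S" if "{p<..n} - S \<noteq> {}"
    using that by (intro Min_in) auto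
  then have "q = p \<and> p \<notin> S \<or> q \<in> {p<..n} - S"
    using assms unfolding space_taken_def by (metis option.distinct(1) option.inject)
  then show "q \<notin> S" and "p \<in> {1..n} \<Longrightarrow> q \<in> {1..n}"
    by auto
qed

text \<open>
  A driver passes every space up to the last one before going home. This is what makes the state of
  the last space decide whether anybody has gone home.
\<close>

lemma space_taken_NoneD:
  assumes "space_taken n S p = None" "p \<le> n"
  shows "n \<in> S"
  using assms by (cases "p = n") (auto simp: space_taken_def split: if_splits)

lemma finite_parked [simp]: "finite (parked n xs)"
  by (induction xs rule: rev_induct) (auto simp: park_step_def split: option.splits)

lemma parked_subset: "set xs \<subseteq> {1..n} \<Longrightarrow> parked n xs \<subseteq> {1..n}"
  by (induction xs rule: rev_induct)
    (auto simp: park_step_def dest: space_taken_SomeD split: option.splits)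

lemma card_parked_le: "card (parked n xs) \<le> length xs"
  by (induction xs rule: rev_induct)
    (auto simp: park_step_def card_insert_if split: option.splits)

lemma card_parked_eq_length:
  assumes "set xs \<subseteq> {..n}" "n \<notin> parked n xs"
  shows "card (parked n xs) = length xs"
  using assms
proof (induction xs rule: rev_induct)
  case (snoc p xs)
  then have "n \<notin> parked n xs" "p \<le> n"
    by (auto simp: park_step_def split: option.splits)
  with snoc show ?case
    by (auto simp: park_step_def dest: space_taken_NoneD space_taken_SomeD split: option.splits)
qed simp

text \<open>
  Each driver either occupies one new space or goes home, so the number of occupied spaces
  determines the number who go home.
\<close>

lemma card_gone_home: "card (gone_home m n f) + card (occupied n f m) = m"
proof (induction m)
  case 0
  show ?case by (simp add: gone_home_def)
next
  case (Suc m)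
  have fin: "finite (gone_home m n f)" "finite (occupied n f m)"
    by (simp_all add: gone_home_def occupied_eq_parked)
  have new: "Suc m \<notin> gone_home m n f"
    by (simp add: gone_home_def)
  have "gone_home (Suc m) n f =
      (if space_taken n (occupied n f m) (f (Suc m)) = None
       then insert (Suc m) (gone_home m n f) else gone_home m n f)"
    by (auto simp: gone_home_def le_Suc_eq)
  with Suc fin new show ?case
    by (auto dest: space_taken_SomeD split: option.splits)
qed

section \<open>Removing the last space\<close>

text \<open>
  Drivers only move towards larger numbers, so what happens in the spaces \<open>1, \<dots>, n\<close> is not
  affected by the space behind them: a driver who would go home from the smaller car park merely tries
  that space too.
\<close>

lemma park_step_Int:
  assumes "p \<in> {1..n}"
  shows "park_step (Suc n) S p \<inter> {1..n} = park_step n (S \<inter> {1..n}) p"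
proof (cases "p \<in> S")
  case False
  then show ?thesis
    using assms by (auto simp: park_step_def space_taken_def)
next
  case True
  have low: "{p<..n} - S \<inter> {1..n} = {p<..n} - S"
    by auto
  show ?thesis
  proof (cases "{p<..n} - S = {}")
    case True
    \<comment> \<open>The driver goes home from the smaller car park, so here at most the last space is left.\<close>
    then have "{p<..Suc n} - S \<subseteq> {Suc n}"
      by (auto simp: le_Suc_eq)
    then have "{p<..Suc n} - S = {} \<or> {p<..Suc n} - S = {Suc n}"
      by blast
    then show ?thesis
      using \<open>p \<in> S\<close> True assms low by (auto simp: park_step_def space_taken_def)
  next
    case False
    define q where "q = Min ({p<..n} - S)"
    have q: "q \<in> {p<..n} - S"
      unfolding q_def using False by (intro Min_in) auto
    have "Min ({p<..Suc n} - S) = q"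
    proof (rule Min_eqI)
      fix x assume "x \<in> {p<..Suc n} - S"
      then have "x = Suc n \<or> x \<in> {p<..n} - S"
        by auto
      moreover have "q \<le> x" if "x \<in> {p<..n} - S"
        unfolding q_def using that by (intro Min_le) auto
      ultimately show "q \<le> x"
        using q by auto
    qed (use q in auto)
    moreover have "{p<..Suc n} - S \<noteq> {}"
      using q by fastforce
    ultimately have "space_taken (Suc n) S p = Some q"
      using \<open>p \<in> S\<close> by (simp add: space_taken_def)
    moreover have "space_taken n (S \<inter> {1..n}) p = Some q"
      using \<open>p \<in> S\<close> False assms low by (simp add: space_taken_def q_def)
    ultimately show ?thesis
      using q by (auto simp: park_step_def)
  qed
qed

lemma park_step_last: "park_step (Suc n) S (Suc n) \<inter> {1..n} = S \<inter> {1..n}"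
  by (auto simp: park_step_def space_taken_def)

lemma parked_Int:
  assumes "set xs \<subseteq> {1..Suc n}"
  shows "parked (Suc n) xs \<inter> {1..n} = parked n (filter (\<lambda>x. x \<in> {1..n}) xs)"
  using assms
proof (induction xs rule: rev_induct)
  case (snoc p xs)
  then have IH: "parked (Suc n) xs \<inter> {1..n} = parked n (filter (\<lambda>x. x \<in> {1..n}) xs)"
    by simp
  show ?case
  proof (cases "p \<in> {1..n}")
    case True
    then show ?thesis
      using park_step_Int[OF True, of "parked (Suc n) xs"] IH by simp
  next
    case False
    with snoc.prems have "p = Suc n"
      by auto
    then show ?thesis
      using park_step_last[of n "parked (Suc n) xs"] IH by simp
  qed
qed simp

text \<open>
  The last space stays free exactly if everybody parks before it. Indeed, if it is free, nobody has gone
  home and all cars stand in the smaller car park; if it is taken, one car is not there. The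
  condition on the number of cars therefore tells the two cases apart in terms of the smaller car
  park alone.
\<close>

lemma card_parked_Suc:
  assumes "set xs \<subseteq> {1..Suc n}"
  defines "ys \<equiv> filter (\<lambda>x. x \<in> {1..n}) xs"
  shows "card (parked (Suc n) xs) =
    (if card (parked n ys) = length xs then length xs else Suc (card (parked n ys)))"
proof (cases "Suc n \<in> parked (Suc n) xs")
  case True
  then have "parked (Suc n) xs = insert (Suc n) (parked n ys)"
    using parked_subset[OF assms(1)] parked_Int[OF assms(1)] unfolding ys_def
    by (fastforce simp: le_Suc_eq)
  moreover have "parked n ys \<subseteq> {1..n}"
    using parked_Int[OF assms(1), folded ys_def] by blast
  then have "Suc n \<notin> parked n ys"
    by auto
  ultimately have "card (parked (Suc n) xs) = Suc (card (parked n ys))"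
    by simp
  with card_parked_le[of "Suc n" xs] show ?thesis
    by simp
next
  case False
  then have "parked (Suc n) xs = parked n ys"
    using parked_subset[OF assms(1)] parked_Int[OF assms(1)] unfolding ys_def
    by (fastforce simp: le_Suc_eq)
  moreover have "card (parked (Suc n) xs) = length xs"
    using assms(1) False by (intro card_parked_eq_length) auto
  ultimately show ?thesis
    by simp
qed

section \<open>Counting preference lists\<close>

text \<open>
  A list with a given filtered list is determined by the positions of the entries that survive
  the filter. The induction on \<open>m\<close> splits by the first entry and so reproduces Pascal's rule.
\<close>

lemma card_lists_filter_eq:
  assumes "a \<notin> A" "finite A" "set ys \<subseteq> A"
  shows "card {xs. length xs = m \<and> set xs \<subseteq> insert a A \<and> filter (\<lambda>x. x \<in> A) xs = ys} =
    m choose length ys"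
  using assms(3)
proof (induction m arbitrary: ys)
  case 0
  have "{xs. length xs = 0 \<and> set xs \<subseteq> insert a A \<and> filter (\<lambda>x. x \<in> A) xs = ys} =
      (if ys = [] then {[]} else {})"
    by auto
  then show ?case
    by simp
next
  case (Suc m)
  define F where
    "F m ys = {xs. length xs = m \<and> set xs \<subseteq> insert a A \<and> filter (\<lambda>x. x \<in> A) xs = ys}" for m ys
  have fin: "finite (F m ys)" for m ys
    by (rule finite_subset[OF _ finite_lists_length_eq[of "insert a A" m]])
      (auto simp: F_def assms(2))
  have IH: "card (F m zs) = m choose length zs" if "set zs \<subseteq> A" for zs
    using Suc.IH[OF that] by (simp add: F_def)
  have "card (F (Suc m) ys) = Suc m choose length ys"
  proof (cases ys)
    case Nil
    have "F (Suc m) [] = (#) a ` F m []"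
      by (auto simp: F_def length_Suc_conv image_iff assms(1) split: if_splits)
    then show ?thesis
      using IH[of "[]"] Nil by (simp add: card_image)
  next
    case (Cons y zs)
    then have y: "y \<in> A" "set zs \<subseteq> A" "y \<noteq> a"
      using Suc.prems assms(1) by auto
    have "F (Suc m) (y # zs) = (#) a ` F m (y # zs) \<union> (#) y ` F m zs"
      using y assms(1) by (auto simp: F_def length_Suc_conv image_iff split: if_splits)
    moreover have "(#) a ` F m (y # zs) \<inter> (#) y ` F m zs = {}"
      using y by auto
    ultimately have "card (F (Suc m) (y # zs)) = card (F m (y # zs)) + card (F m zs)"
      using fin by (simp add: card_Un_disjoint card_image)
    then show ?thesis
      using y Cons IH[of "y # zs"] IH[of zs] by simp
  qed
  then show ?case
    by (simp add: F_def)
qed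

lemma card_lists_filter:
  assumes "a \<notin> A" "finite A"
  shows "card {xs. length xs = m \<and> set xs \<subseteq> insert a A \<and> P (filter (\<lambda>x. x \<in> A) xs)} =
    (\<Sum>j\<le>m. (m choose j) * card {ys. length ys = j \<and> set ys \<subseteq> A \<and> P ys})"
proof -
  define F where
    "F ys = {xs. length xs = m \<and> set xs \<subseteq> insert a A \<and> filter (\<lambda>x. x \<in> A) xs = ys}" for ys
  define Y where "Y j = {ys. length ys = j \<and> set ys \<subseteq> A \<and> P ys}" for j
  have finF: "finite (F ys)" for ys
    by (rule finite_subset[OF _ finite_lists_length_eq[of "insert a A" m]])
      (auto simp: F_def assms(2))
  have finY: "finite (Y j)" for j
    by (rule finite_subset[OF _ finite_lists_length_eq[of A j]]) (auto simp: Y_def assms(2))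
  have "{xs. length xs = m \<and> set xs \<subseteq> insert a A \<and> P (filter (\<lambda>x. x \<in> A) xs)} =
      (\<Union>ys\<in>(\<Union>j\<le>m. Y j). F ys)"
    by (auto simp: F_def Y_def)
  also have "card \<dots> = (\<Sum>ys\<in>(\<Union>j\<le>m. Y j). card (F ys))"
    by (rule card_UN_disjoint) (use finF finY in \<open>auto simp: F_def\<close>)
  also have "\<dots> = (\<Sum>j\<le>m. \<Sum>ys\<in>Y j. card (F ys))"
    by (rule sum.UNION_disjoint) (use finY in \<open>auto simp: Y_def\<close>)
  also have "\<dots> = (\<Sum>j\<le>m. \<Sum>ys\<in>Y j. m choose j)"
    by (intro sum.cong refl) (auto simp: Y_def F_def card_lists_filter_eq[OF assms])
  finally show ?thesis
    by (simp add: Y_def mult.commute)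
qed

definition park_count :: "nat \<Rightarrow> nat \<Rightarrow> nat \<Rightarrow> nat" where
  "park_count n m s = card {xs. length xs = m \<and> set xs \<subseteq> {1..n} \<and> card (parked n xs) = s}"

lemma bij_betw_PiE_lists:
  "bij_betw (\<lambda>f. map f [1..<Suc m]) ({1..m} \<rightarrow>\<^sub>E A) {xs. length xs = m \<and> set xs \<subseteq> A}"
proof (rule bij_betw_byWitness[where f' = "\<lambda>xs. restrict (\<lambda>i. xs ! (i - 1)) {1..m}"])
  show "\<forall>f\<in>{1..m} \<rightarrow>\<^sub>E A. restrict (\<lambda>i. map f [1..<Suc m] ! (i - 1)) {1..m} = f"
    by (auto simp: fun_eq_iff restrict_def PiE_def extensional_def simp del: upt_Suc)
  show "\<forall>xs\<in>{xs. length xs = m \<and> set xs \<subseteq> A}.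
      map (restrict (\<lambda>i. xs ! (i - 1)) {1..m}) [1..<Suc m] = xs"
    by (auto intro!: nth_equalityI simp del: upt_Suc)
  show "(\<lambda>f. map f [1..<Suc m]) ` ({1..m} \<rightarrow>\<^sub>E A) \<subseteq> {xs. length xs = m \<and> set xs \<subseteq> A}"
    by (auto simp: less_Suc_eq_le PiE_iff simp del: upt_Suc)
  show "(\<lambda>xs. restrict (\<lambda>i. xs ! (i - 1)) {1..m}) ` {xs. length xs = m \<and> set xs \<subseteq> A}
      \<subseteq> {1..m} \<rightarrow>\<^sub>E A"
    by (fastforce simp: subset_iff)
qed

text \<open>
  With \<open>s + k\<close> drivers and \<open>r + s\<close> spaces, having \<open>s\<close> occupied spaces already forces \<open>r\<close> free spaces and
  \<open>k\<close> drivers at home.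
\<close>

lemma num_assignments_eq_park_count:
  "num_assignments r s k = park_count (r + s) (s + k) s"
proof -
  let ?n = "r + s" and ?m = "s + k"
  let ?P = "\<lambda>xs. card (parked ?n xs) = s"
  let ?l = "\<lambda>f::nat \<Rightarrow> nat. map f [1..<Suc ?m]"
  have "card ({1..?n} - occupied ?n f ?m) = r \<and> card (occupied ?n f ?m) = s
      \<and> card (gone_home ?m ?n f) = k \<longleftrightarrow> ?P (?l f)" if f: "f \<in> {1..?m} \<rightarrow>\<^sub>E {1..?n}" for f
  proof -
    have "set (?l f) \<subseteq> {1..?n}"
      using f by (auto simp del: upt_Suc)
    then have "parked ?n (?l f) \<subseteq> {1..?n}"
      by (rule parked_subset)
    then have "card ({1..?n} - occupied ?n f ?m) = ?n - card (occupied ?n f ?m)"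
      unfolding occupied_eq_parked by (subst card_Diff_subset) auto
    with card_gone_home[of ?m ?n f] show ?thesis
      unfolding occupied_eq_parked by auto
  qed
  then have "num_assignments r s k = card {f \<in> {1..?m} \<rightarrow>\<^sub>E {1..?n}. ?P (?l f)}"
    unfolding num_assignments_def by (intro arg_cong[where f = card]) blast
  also have "\<dots> = card {xs \<in> {xs. length xs = ?m \<and> set xs \<subseteq> {1..?n}}. ?P xs}"
    by (rule bij_betw_same_card[of ?l], rule bij_betw_Collect[OF bij_betw_PiE_lists]) simp
  finally show ?thesis
    by (simp add: park_count_def conj_assoc)
qed

lemma park_count_eq_0: "m < s \<or> n < s \<Longrightarrow> park_count n m s = 0"
proof -
  assume a: "m < s \<or> n < s"
  have "card (parked n xs) \<le> n" if "set xs \<subseteq> {1..n}" for xs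
    using card_mono[OF _ parked_subset[OF that]] by simp
  with a have "{xs. length xs = m \<and> set xs \<subseteq> {1..n} \<and> card (parked n xs) = s} = {}"
    using card_parked_le[of n] by (metis (mono_tags, lifting) empty_Collect_eq not_le)
  then show ?thesis
    unfolding park_count_def by (simp only: card.empty)
qed

lemma park_count_0: "park_count 0 m s = (if m = 0 \<and> s = 0 then 1 else 0)"
proof -
  have "{xs. length xs = m \<and> set xs \<subseteq> {1..0} \<and> card (parked 0 xs) = s} =
      (if m = 0 \<and> s = 0 then {[]} else {})"
    by auto
  then show ?thesis
    unfolding park_count_def by simp
qed

text \<open>
  The two summands count the lists that leave the last space free and those that fill it. In the
  second one, \<open>j\<close> is the number of drivers who prefer one of the first \<open>n\<close> spaces. With \<open>m < s\<close>
  the left-hand side is zero, but the sum need not be.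
\<close>

lemma park_count_Suc:
  assumes "s \<le> m"
  shows "park_count (Suc n) m s =
    (if s = m then park_count n m s else 0) +
    (if s = 0 then 0 else \<Sum>j\<le>m. (m choose j) * park_count n j (s - 1))"
proof -
  let ?fl = "filter (\<lambda>x. x \<in> {1..n})"
  let ?A = "\<lambda>P. {xs. length xs = m \<and> set xs \<subseteq> insert (Suc n) {1..n} \<and> P (?fl xs)}"
  let ?free = "\<lambda>ys. card (parked n ys) = m \<and> s = m"
  let ?occ = "\<lambda>ys. card (parked n ys) = s - 1 \<and> s \<noteq> 0"
  have count: "card (?A P) = (\<Sum>j\<le>m. (m choose j) * card {ys. length ys = j \<and> set ys \<subseteq> {1..n} \<and> P ys})"
    for P by (rule card_lists_filter) auto
  have ins: "{1..Suc n} = insert (Suc n) {1..n}"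
    by auto
  have fin: "finite (?A P)" for P
    by (rule finite_subset[OF _ finite_lists_length_eq[of "{1..Suc n}" m]]) auto
  have "card (parked (Suc n) xs) = s \<longleftrightarrow> ?free (?fl xs) \<or> ?occ (?fl xs)"
    if "length xs = m" "set xs \<subseteq> {1..Suc n}" for xs
    using card_parked_Suc[OF that(2)] that(1) assms by auto
  then have "{xs. length xs = m \<and> set xs \<subseteq> {1..Suc n} \<and> card (parked (Suc n) xs) = s} = ?A ?free \<union> ?A ?occ"
    unfolding ins by blast
  moreover have "?A ?free \<inter> ?A ?occ = {}"
  proof -
    have "\<not> (?free ys \<and> ?occ ys)" for ys
      by linarith
    then show ?thesis
      by blast
  qed
  ultimately have "park_count (Suc n) m s = card (?A ?free) + card (?A ?occ)"
    unfolding park_count_def using fin[of ?free] fin[of ?occ] by (simp only: card_Un_disjoint)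
  moreover have "card (?A ?free) = (if s = m then park_count n m s else 0)"
  proof (cases "s = m")
    case True
    then have "card (?A ?free) = (\<Sum>j\<le>m. (m choose j) * park_count n j m)"
      using count[of ?free] by (simp add: park_count_def)
    also have "\<dots> = (\<Sum>j\<le>m. if j = m then park_count n m m else 0)"
      by (intro sum.cong) (auto simp: park_count_eq_0)
    finally show ?thesis
      using True by simp
  qed simp
  moreover have "card (?A ?occ) = (if s = 0 then 0 else \<Sum>j\<le>m. (m choose j) * park_count n j (s - 1))"
    using count[of ?occ] by (cases "s = 0") (simp_all add: park_count_def)
  ultimately show ?thesis
    by simp
qed

text \<open>
  This is \<open>park_count_Suc\<close> in the parameters \<open>r\<close>, \<open>s\<close>, \<open>k\<close>, together with the empty car park.
  A smaller car park with \<open>s - 1\<close> occupied spaces has \<open>j = s - 1 + i\<close> drivers, where \<open>i\<close> go home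
  from it.
\<close>

lemma num_assignments_rec:
  "num_assignments r s k =
    (if k = 0 then (if s = 0 \<and> r = 0 then 1 else 0) +
       (if r = 0 then 0 else num_assignments (r - 1) s 0) else 0) +
    (if s = 0 then 0 else \<Sum>i\<le>Suc k. (s + k choose (s - 1 + i)) * num_assignments r (s - 1) i)"
proof (cases "r + s")
  case 0
  then show ?thesis
    by (simp add: num_assignments_eq_park_count park_count_0)
next
  case (Suc n)
  have free: "park_count n s s = (if r = 0 then 0 else num_assignments (r - 1) s 0)"
  proof (cases "r = 0")
    case True
    then show ?thesis
      using Suc by (simp add: park_count_eq_0)
  next
    case False
    then have "n = r - 1 + s"
      using Suc by simp
    then show ?thesis
      using False by (simp add: num_assignments_eq_park_count)
  qed
  have occ: "(\<Sum>j\<le>s + k. (s + k choose j) * park_count n j (s - 1)) =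
      (\<Sum>i\<le>Suc k. (s + k choose (s - 1 + i)) * num_assignments r (s - 1) i)" if "s \<noteq> 0"
  proof -
    have n: "n = r + (s - 1)"
      using Suc that by simp
    have "(\<Sum>j\<le>s + k. (s + k choose j) * park_count n j (s - 1)) =
        (\<Sum>j\<in>{s - 1..s + k}. (s + k choose j) * park_count n j (s - 1))"
      by (intro sum.mono_neutral_right) (auto simp: park_count_eq_0)
    also have "\<dots> = (\<Sum>i\<le>Suc k. (s + k choose (s - 1 + i)) * park_count n (s - 1 + i) (s - 1))"
      by (rule sum.reindex_bij_witness[of _ "\<lambda>i. s - 1 + i" "\<lambda>j. j - (s - 1)"])
        (use that in auto)
    finally show ?thesis
      by (simp add: num_assignments_eq_park_count n)
  qed
  have "num_assignments r s k = (if k = 0 then park_count n s s else 0) +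
      (if s = 0 then 0 else \<Sum>j\<le>s + k. (s + k choose j) * park_count n j (s - 1))"
    using park_count_Suc[of s "s + k" n] by (simp add: num_assignments_eq_park_count Suc)
  then show ?thesis
    using free occ Suc by auto
qed

section \<open>The functional equation as a recurrence\<close>

text \<open>
  The three summands are the coefficients of \<open>1\<close>, of \<open>u A(u,v,0)\<close> and of \<open>(v/t) (e^t A - A(u,v,0))\<close>.
\<close>

definition parking_recurrence :: "'a::field_char_0 fps fps fps \<Rightarrow> bool" where
  "parking_recurrence B \<longleftrightarrow> (\<forall>k s r. B $ k $ s $ r =
     (if k = 0 then (if s = 0 \<and> r = 0 then 1 else 0) +
        (if r = 0 then 0 else B $ 0 $ s $ (r - 1)) else 0) +
     (if s = 0 then 0 else \<Sum>i\<le>Suc k. B $ i $ (s - 1) $ r / fact (Suc k - i)))"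

lemma exp_mult_nth:
  fixes B :: "'a::field_char_0 fps fps fps"
  shows "(fps_exp 1 * B) $ k $ s $ r = (\<Sum>i\<le>k. B $ i $ s $ r / fact (k - i))"
proof -
  have "(fps_exp 1 * B) $ k $ s $ r =
      (B * fps_exp 1) $ k $ s $ r"
    by (simp add: mult.commute)
  also have "\<dots> = (\<Sum>i\<le>k. (B $ i * fps_const (fps_const (1 / fact (k - i)))) $ s $ r)"
    by (simp only: fps_mult_nth[of B] fps_sum_nth fps_exp_1_nth atLeast0AtMost)
  finally show ?thesis
    by simp
qed

lemma equation_iff_recurrence:
  fixes B :: "'a::field_char_0 fps fps fps"
  shows "0 = (v_var * t_inv * exp_t - 1) * fps_to_fls B
             + (u_var - v_var * t_inv) * at_t_zero B + 1 \<longleftrightarrow> parking_recurrence B"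
    (is "0 = ?E \<longleftrightarrow> _")
proof -
  define E where "E = fps_exp 1 * B"
  have E_nth: "E $ k $ s $ r = (\<Sum>i\<le>k. B $ i $ s $ r / fact (k - i))" for k s r
    unfolding E_def by (rule exp_mult_nth)
  \<comment> \<open>The right-hand side of the equation, multiplied by \<open>t\<close>\<close>
  define G :: "'a fps fps fps" where
    "G = fps_const fps_X * E - fps_X * B
       + fps_const (fps_const fps_X * B $ 0) * fps_X - fps_const (fps_X * B $ 0) + fps_X"
  have t: "fls_X * t_inv = (1 :: 'a fps fps fls)"
    using t_inv_times_t by (simp add: mult.commute)
  have "fls_X * ?E = (fls_X * t_inv) * v_var * exp_t * fps_to_fls B - fls_X * fps_to_fls B
      + fls_X * u_var * at_t_zero B - (fls_X * t_inv) * v_var * at_t_zero B + fls_X"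
    by (simp add: algebra_simps)
  also have "\<dots> = fps_to_fls G"
    unfolding t G_def E_def v_var_def u_var_def exp_t_def at_t_zero_def
    by (simp add: fls_times_fps_to_fls fps_to_fls_plus fps_to_fls_minus mult_ac
        flip: fls_const_mult_const)
  finally have G: "fls_X * ?E = fps_to_fls G" .
  have "0 = ?E \<longleftrightarrow> fls_X * ?E = 0"
    by auto
  also have "\<dots> \<longleftrightarrow> G = 0"
    unfolding G by (simp add: fps_to_fls_eq_0_iff)
  also have "\<dots> \<longleftrightarrow> (\<forall>k s r. G $ k $ s $ r = 0)"
    by (auto simp: fps_eq_iff)
  also have "\<dots> \<longleftrightarrow> (\<forall>k s r. G $ Suc k $ s $ r = 0)"
  proof -
    have "G $ 0 $ s $ r = 0" for s r
      by (simp add: G_def E_nth)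
    then show ?thesis
      by (metis not0_implies_Suc)
  qed
  also have "\<dots> \<longleftrightarrow> parking_recurrence B"
  proof -
    have "G $ Suc k $ s $ r =
       ((if k = 0 then (if s = 0 \<and> r = 0 then 1 else 0) +
          (if r = 0 then 0 else B $ 0 $ s $ (r - 1)) else 0) +
        (if s = 0 then 0 else \<Sum>i\<le>Suc k. B $ i $ (s - 1) $ r / fact (Suc k - i)))
       - B $ k $ s $ r" for k s r
      unfolding G_def by (simp add: E_nth del: sum.atMost_Suc)
    then show ?thesis
      unfolding parking_recurrence_def
      by (simp only: right_minus_eq) (simp only: eq_commute)
  qed
  finally show ?thesis .
qed

text \<open>
  Induction on the exponent of \<open>v\<close>. The series without \<open>t\<close> comes first in each layer, by
  induction on the exponent of \<open>u\<close>.
\<close>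

lemma parking_recurrence_unique:
  assumes "parking_recurrence B" "parking_recurrence C"
  shows "B = C"
proof -
  have base: "B $ 0 $ s $ r = C $ 0 $ s $ r"
    if "\<And>k r. s \<noteq> 0 \<Longrightarrow> B $ k $ (s - 1) $ r = C $ k $ (s - 1) $ r" for s r
  proof (induction r)
    case 0
    show ?case
      using assms[unfolded parking_recurrence_def, rule_format, of 0 s 0] that by simp
  next
    case (Suc r)
    then show ?case
      using assms[unfolded parking_recurrence_def, rule_format, of 0 s "Suc r"] that by simp
  qed
  have "\<forall>k r. B $ k $ s $ r = C $ k $ s $ r" for s
  proof (induction s)
    case 0
    have "B $ k $ 0 $ r = C $ k $ 0 $ r" for k r
      using assms[unfolded parking_recurrence_def, rule_format, of k 0 r] base[of 0] by simp
    then show ?case by blast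
  next
    case (Suc s)
    have "B $ k $ Suc s $ r = C $ k $ Suc s $ r" for k r
      using assms[unfolded parking_recurrence_def, rule_format, of k "Suc s" r] base[of "Suc s"] Suc
      by simp
    then show ?case by blast
  qed
  then show ?thesis
    by (auto simp: fps_eq_iff)
qed

text \<open>
  Since \<open>s + k - (s - 1 + i) = k + 1 - i\<close>, dividing the binomial coefficient by \<open>(s+k)!\<close> leaves
  the normalising factor \<open>1/(s-1+i)!\<close> of the series and the coefficient \<open>1/(k+1-i)!\<close> of \<open>e^t\<close>.
\<close>

lemma parking_series_recurrence: "parking_recurrence (parking_series :: 'a::field_char_0 fps fps fps)"
proof -
  have nth: "(parking_series :: 'a fps fps fps) $ k $ s $ r =
      of_nat (num_assignments r s k) / fact (s + k)" for k s r
    by (simp add: parking_series_def)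
  have binom: "of_nat (s + k choose (s - 1 + i)) / fact (s + k) =
      (1 / (fact (s - 1 + i) * fact (Suc k - i)) :: 'a)" if "s \<noteq> 0" "i \<le> Suc k" for s k i
  proof -
    have "s - 1 + i \<le> s + k" "s + k - (s - 1 + i) = Suc k - i"
      using that by auto
    then show ?thesis
      by (simp add: binomial_fact)
  qed
  have occ: "of_nat (\<Sum>i\<le>Suc k. (s + k choose (s - 1 + i)) * num_assignments r (s - 1) i) / fact (s + k)
      = (\<Sum>i\<le>Suc k. (parking_series :: 'a fps fps fps) $ i $ (s - 1) $ r / fact (Suc k - i))"
    if "s \<noteq> 0" for k s r
    unfolding of_nat_sum sum_divide_distrib
  proof (intro sum.cong refl)
    fix i assume "i \<in> {..Suc k}"
    then show "of_nat ((s + k choose (s - 1 + i)) * num_assignments r (s - 1) i) / fact (s + k) =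
        (parking_series :: 'a fps fps fps) $ i $ (s - 1) $ r / fact (Suc k - i)"
      using binom[OF that, of i k] by (simp add: nth field_simps)
  qed
  show ?thesis
    unfolding parking_recurrence_def
  proof (intro allI)
    fix k s r
    let ?occ = "\<Sum>i\<le>Suc k. (s + k choose (s - 1 + i)) * num_assignments r (s - 1) i"
    have "(parking_series :: 'a fps fps fps) $ k $ s $ r =
       (if k = 0 then (if s = 0 \<and> r = 0 then 1 else 0) +
          (if r = 0 then 0 else parking_series $ 0 $ s $ (r - 1)) else 0) +
       (if s = 0 then 0 else of_nat ?occ / fact (s + k))"
      unfolding nth by (subst num_assignments_rec) (simp add: add_divide_distrib del: sum.atMost_Suc)
    then show "(parking_series :: 'a fps fps fps) $ k $ s $ r =
       (if k = 0 then (if s = 0 \<and> r = 0 then 1 else 0) +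
          (if r = 0 then 0 else parking_series $ 0 $ s $ (r - 1)) else 0) +
       (if s = 0 then 0 else
          \<Sum>i\<le>Suc k. parking_series $ i $ (s - 1) $ r / fact (Suc k - i))"
      using occ[of s k r] by (simp del: sum.atMost_Suc of_nat_sum)
  qed
qed

theorem lemma3:
  fixes B :: "'a::field_char_0 fps fps fps"
  shows "0 = (v_var * t_inv * exp_t - 1) * fps_to_fls B
             + (u_var - v_var * t_inv) * at_t_zero B + 1
         \<longleftrightarrow> B = parking_series"
  using equation_iff_recurrence[of B] parking_series_recurrence parking_recurrence_unique by blast

end
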